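(* Let $(L,\leq)$ be a finite lower locally distributive lattice, $f:L\to\mathbb{R}$, and let $m:L\to\mathbb{R}$ be the Möbius transform of $f$, i.e. the unique function with $f(x)=\sum_{y\leq x}m(y)$ for all $x\in L$. Let $x,y\in L$ be such that the derivative $\Delta_y f(x)$ is Boolean. Then \[\Delta_y f(x)=\sum_{z\in[y,x\vee y]}m(z).\]
   Context: A finite lattice is lower locally distributive if it is lower semi-modular (for all $x,y$, if $x\vee y$ covers both $x$ and $y$ then $x$ and $y$ both cover $x\wedge y$) and contains no sublattice isomorphic to $M_3$. $\mathcal{J}(L)$ denotes the set of join-irreducible elements (non-bottom elements covering exactly one element). In such a lattice every $y$ has a unique decomposition $y=\bigvee\eta^*(y)$ into join-irreducible elements of minimal cardinality (minimal decomposition $\eta^*(y)$). For $i\in\mathcal{J}(L)$, $\Delta_i f(x):=f(x\vee i)-f(x)$. If $\eta^*(y)=\{i_1,\ldots,i_k\}$, $\Delta_y f(x):=\Delta_{i_1}(\Delta_{i_2}(\cdots\Delta_{i_k}f(x)\cdots))$. This derivative is called Boolean if the interval $[x,x\vee y]$ is isomorphic to the Boolean lattice $2^k$, $k=|\eta^*(y)|$. *)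

theory Defs
  imports Complex_Main "HOL-Library.Finite_Lattice"
begin

definition covers :: "'a::order \<Rightarrow> 'a \<Rightarrow> bool" (infix \<open>covers\<close> 50) where
  "x covers y \<longleftrightarrow> y < x \<and> \<not> (\<exists>z. y < z \<and> z < x)"

definition lower_semimodular :: "'a::lattice itself \<Rightarrow> bool" where
  "lower_semimodular _ \<longleftrightarrow>
     (\<forall>x y :: 'a. sup x y covers x \<and> sup x y covers y \<longrightarrow> x covers inf x y \<and> y covers inf x y)"

definition sublattice :: "'a::lattice set \<Rightarrow> bool" where
  "sublattice S \<longleftrightarrow> (\<forall>x\<in>S. \<forall>y\<in>S. sup x y \<in> S \<and> inf x y \<in> S)"

text \<open>Between lattices, order isomorphisms are the same as lattice isomorphisms.\<close>

definition order_isomorphic :: "'a::order set \<Rightarrow> 'b::order set \<Rightarrow> bool" where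
  "order_isomorphic A B \<longleftrightarrow>
     (\<exists>\<phi>. bij_betw \<phi> A B \<and> (\<forall>a\<in>A. \<forall>b\<in>A. a \<le> b \<longleftrightarrow> \<phi> a \<le> \<phi> b))"

text \<open>The diamond lattice (a bottom, a top and three pairwise incomparable elements), realised as a
  family of sets ordered by inclusion.\<close>

definition M3 :: "nat set set" where
  "M3 = {{}, {0}, {1}, {2}, {0, 1, 2}}"

definition lower_locally_distributive :: "'a::lattice itself \<Rightarrow> bool" where
  "lower_locally_distributive L \<longleftrightarrow>
     lower_semimodular L \<and> \<not> (\<exists>S :: 'a set. sublattice S \<and> order_isomorphic S M3)"

definition join_irreducibles :: "'a::bounded_lattice_bot set" where
  "join_irreducibles = {j. j \<noteq> bot \<and> (\<exists>!y. j covers y)}"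

definition decomposition :: "'a::complete_lattice \<Rightarrow> 'a set \<Rightarrow> bool" where
  "decomposition y \<eta> \<longleftrightarrow> \<eta> \<subseteq> join_irreducibles \<and> Sup \<eta> = y"

text \<open>The description below is proper in a finite lower locally distributive lattice, where the
  decomposition of minimal cardinality is unique. Note that the decomposition of the bottom
  element is empty.\<close>

definition min_decomposition :: "'a::complete_lattice \<Rightarrow> 'a set" where
  "min_decomposition y =
     (THE \<eta>. decomposition y \<eta> \<and> (\<forall>\<eta>'. decomposition y \<eta>' \<longrightarrow> card \<eta> \<le> card \<eta>'))"

definition irr_derivative :: "'a::lattice \<Rightarrow> ('a \<Rightarrow> real) \<Rightarrow> 'a \<Rightarrow> real" where
  "irr_derivative i f x = f (sup x i) - f x"

text \<open>The operators \<^term>\<open>irr_derivative i\<close> commute, so the order of the iteration over the minimal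
  decomposition is irrelevant and the fold is well defined.\<close>

definition derivative :: "'a::complete_lattice \<Rightarrow> ('a \<Rightarrow> real) \<Rightarrow> 'a \<Rightarrow> real" where
  "derivative y f = Finite_Set.fold irr_derivative f (min_decomposition y)"

definition boolean_derivative :: "'a::complete_lattice \<Rightarrow> 'a \<Rightarrow> bool" where
  "boolean_derivative y x \<longleftrightarrow>
     order_isomorphic {x..sup x y} (Pow {..<card (min_decomposition y)})"

lemma comp_fun_commute_irr_derivative:
  "comp_fun_commute (irr_derivative :: 'a::lattice \<Rightarrow> ('a \<Rightarrow> real) \<Rightarrow> 'a \<Rightarrow> real)"
  by standard (simp add: fun_eq_iff irr_derivative_def ac_simps)

lemma derivative_eq_foldr:
  assumes "set is = min_decomposition y" "distinct is"
  shows "derivative y f = foldr irr_derivative is f"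
proof -
  interpret comp_fun_commute "irr_derivative :: 'a \<Rightarrow> ('a \<Rightarrow> real) \<Rightarrow> 'a \<Rightarrow> real"
    by (rule comp_fun_commute_irr_derivative)
  have "Finite_Set.fold irr_derivative f (set is) = foldr irr_derivative is f"
    using assms(2) by (induction "is") auto
  then show ?thesis
    by (simp add: derivative_def assms(1))
qed

lemma Moebius_transform_ex1:
  fixes f :: "'a::{finite,order} \<Rightarrow> real"
  shows "\<exists>!m. \<forall>x. f x = (\<Sum>y\<in>{..x}. m y)"
proof -
  have wf: "wf {(y, x :: 'a). y < x}"
    by (rule wf_subset[OF wf_measure[of "\<lambda>x. card {..<x}"]])
      (force intro!: psubset_card_mono)
  have split: "(\<Sum>y\<in>{..x}. m y) = m x + (\<Sum>y\<in>{..<x}. m y)" for x and m :: "'a \<Rightarrow> real"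
  proof -
    have "{..x} = insert x {..<x}" by auto
    then show ?thesis by simp
  qed
  define m where "m = wfrec {(y, x :: 'a). y < x} (\<lambda>m x. f x - (\<Sum>y\<in>{..<x}. m y))"
  have m: "m x = f x - (\<Sum>y\<in>{..<x}. m y)" for x
    unfolding m_def by (subst wfrec[OF wf]) (simp add: cut_def)
  show ?thesis
  proof (rule ex1I[of _ m])
    show "\<forall>x. f x = (\<Sum>y\<in>{..x}. m y)"
    proof
      fix x show "f x = (\<Sum>y\<in>{..x}. m y)"
        unfolding split using m[of x] by linarith
    qed
  next
    fix m' assume m': "\<forall>x. f x = (\<Sum>y\<in>{..x}. m' y)"
    show "m' = m"
    proof
      fix x show "m' x = m x"
      proof (induction x rule: wf_induct_rule[OF wf])
        case (1 x)
        have "(\<Sum>y\<in>{..<x}. m' y) = (\<Sum>y\<in>{..<x}. m y)"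
          using 1 by (intro sum.cong) auto
        then show ?case
          using m[of x] m'[rule_format, of x] split[of m' x] by linarith
      qed
    qed
  qed
qed

end

theory Submission
  imports Defs
begin

text \<open>In a finite lower locally distributive lattice, every covering pair \<open>c < t\<close> has exactly one
  join-irreducible element \<open>j \<le> t\<close> with \<open>\<not> j \<le> c\<close>. Hence the minimal decomposition of \<open>y\<close> is contained
  in every other decomposition of \<open>y\<close>.

  Put \<open>t = x \<squnion> y\<close>. If \<open>[x, t]\<close> is Boolean of rank \<open>k\<close>, its \<open>k\<close> coatoms \<open>c\<close> give \<open>k\<close> distinct
  join-irreducible elements, one below \<open>t\<close> but not below \<open>c\<close> for each \<open>c\<close>. All of them lie in the
  minimal decomposition of \<open>y\<close>, which has \<open>k\<close> elements, so it consists of them. It follows that, for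
  \<open>S\<close> contained in the minimal decomposition, \<open>z \<le> x \<squnion> \<Squnion>S\<close> if and only if \<open>z \<le> t\<close> and \<open>S\<close>
  contains all elements of the decomposition below \<open>z\<close>. Each difference operator \<open>\<Delta>\<^sub>p\<close> therefore
  restricts the sum of the Moebius transform to those \<open>z\<close> that lie above \<open>p\<close>.\<close>

section \<open>Covers\<close>

lemma covers_less: "t covers c \<Longrightarrow> c < t"
  by (simp add: covers_def)

lemma covers_eqI:
  assumes "t covers c" "c \<le> z" "z < t"
  shows "z = c"
  using assms by (auto simp: covers_def order.order_iff_strict)

lemma covers_sup_eq:
  fixes t c s :: "'a::lattice"
  assumes "t covers c" "s \<le> t" "\<not> s \<le> c"
  shows "sup s c = t"
proof -
  have "sup s c \<le> t" using assms covers_less[OF assms(1)] by (simp add: less_imp_le)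
  moreover have "sup s c \<noteq> c" using assms(3) by (metis sup.cobounded1)
  ultimately show ?thesis
    using covers_eqI[OF assms(1), of "sup s c"] by (meson order.not_eq_order_implies_strict sup.cobounded2)
qed

lemma ex_covers_above:
  fixes s t :: "'a::{finite,order}"
  assumes "s < t"
  shows "\<exists>d. t covers d \<and> s \<le> d"
proof -
  obtain d where d: "d \<in> {z. s \<le> z \<and> z < t}"
    and max: "\<And>b. b \<in> {z. s \<le> z \<and> z < t} \<Longrightarrow> d \<le> b \<Longrightarrow> d = b"
    using finite_has_maximal[of "{z. s \<le> z \<and> z < t}"] assms by auto
  have "\<not> (d < z \<and> z < t)" for z
  proof
    assume z: "d < z \<and> z < t"
    with d have "s \<le> z" by auto
    with z max[of z] have "d = z" by (simp add: less_imp_le)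
    with z show False by simp
  qed
  with d show ?thesis by (auto simp: covers_def)
qed

lemma finite_order_less_induct [case_names less]:
  fixes t :: "'a::{finite,order}"
  assumes "\<And>t. (\<And>s. s < t \<Longrightarrow> P s) \<Longrightarrow> P t"
  shows "P t"
proof -
  have "wf {(y, x :: 'a). y < x}"
    by (rule wf_subset[OF wf_measure[of "\<lambda>x. card {..<x}"]])
      (force intro!: psubset_card_mono)
  then show ?thesis
    by (induction t rule: wf_induct_rule) (auto intro: assms)
qed

text \<open>A minimal element \<open>j\<close> below \<open>a\<close> but not below \<open>c\<close>
  works: everything strictly below \<open>j\<close> lies below \<open>c\<close>. Two distinct lower
  covers would have join \<open>j\<close>, forcing \<open>j \<le> c\<close>.\<close>

lemma ex_join_irreducible:
  fixes a c :: "'a::{finite,bounded_lattice_bot}"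
  assumes "\<not> a \<le> c"
  shows "\<exists>j\<in>join_irreducibles. j \<le> a \<and> \<not> j \<le> c"
proof -
  obtain j where j: "j \<in> {z. z \<le> a \<and> \<not> z \<le> c}"
    and min: "\<And>b. b \<in> {z. z \<le> a \<and> \<not> z \<le> c} \<Longrightarrow> b \<le> j \<Longrightarrow> j = b"
    using finite_has_minimal[of "{z. z \<le> a \<and> \<not> z \<le> c}"] assms by auto
  have below: "z \<le> c" if "z < j" for z
  proof (rule ccontr)
    assume "\<not> z \<le> c"
    moreover have "z \<le> a" using that j by auto
    ultimately show False using min[of z] that by (auto simp: less_le)
  qed
  have "j \<noteq> bot" using j by auto
  then obtain d where d: "j covers d" using ex_covers_above[of bot j] bot.not_eq_extremum by auto
  have "e = d" if e: "j covers e" for e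
  proof (rule ccontr)
    assume "e \<noteq> d"
    then have "\<not> e \<le> d" using covers_eqI[OF e _ covers_less[OF d]] by auto
    then have "sup e d = j" using covers_sup_eq[OF d] covers_less[OF e] by auto
    moreover have "sup e d \<le> c" using below covers_less d e by auto
    ultimately show False using j by auto
  qed
  with d \<open>j \<noteq> bot\<close> j show ?thesis by (auto simp: join_irreducibles_def)
qed

lemma join_irreducible_covers_above:
  fixes j :: "'a::{finite,bounded_lattice_bot}"
  assumes "j \<in> join_irreducibles" "j covers c" "a < j"
  shows "a \<le> c"
  using ex_covers_above[OF assms(3)] assms(1,2) by (auto simp: join_irreducibles_def)

text \<open>Extends the semimodular law from two lower covers of \<open>t\<close> to any
  \<open>s \<le> t\<close>. Pass to a lower cover \<open>d\<close> of \<open>t\<close> above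
  \<open>s\<close>; then \<open>d covers inf d c\<close>, and the same argument continues inside
  \<open>d\<close>.\<close>

lemma lower_semimodular_covers_inf:
  fixes t c s :: "'a::{finite,lattice}"
  assumes lsm: "lower_semimodular TYPE('a)"
  shows "t covers c \<Longrightarrow> s \<le> t \<Longrightarrow> \<not> s \<le> c \<Longrightarrow> s covers inf s c"
proof (induction t arbitrary: c rule: finite_order_less_induct)
  case (less t)
  have ct: "c < t" by (rule covers_less[OF less.prems(1)])
  show ?case
  proof (cases "s = t")
    case True
    with less.prems ct show ?thesis by (simp add: inf_absorb2)
  next
    case False
    with less.prems obtain d where d: "t covers d" "s \<le> d"
      using ex_covers_above[of s t] by (auto simp: less_le)
    have ndc: "\<not> d \<le> c" using d(2) less.prems(3) order_trans by blast
    have "sup d c = t" using covers_sup_eq[OF less.prems(1) _ ndc] covers_less[OF d(1)] by auto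
    then have "d covers inf d c"
      using lsm d(1) less.prems(1) unfolding lower_semimodular_def by metis
    moreover have "\<not> s \<le> inf d c" using less.prems(3) by simp
    ultimately have "s covers inf s (inf d c)"
      using less.IH[OF covers_less[OF d(1)]] d(2) by blast
    then show ?thesis using d(2) by (simp add: inf_absorb1 flip: inf_assoc)
  qed
qed

section \<open>Lower locally distributive lattices\<close>

lemma M3_sublattice:
  fixes a b c e t :: "'a::lattice"
  assumes "inf a b = e" "inf b c = e" "inf a c = e"
    and "sup a b = t" "sup b c = t" "sup a c = t"
    and "e \<noteq> t"
  shows "\<exists>S :: 'a set. sublattice S \<and> order_isomorphic S M3"
proof -
  have le: "e \<le> a" "e \<le> b" "e \<le> c" "a \<le> t" "b \<le> t" "c \<le> t"
    using assms by (metis inf.cobounded1 inf.cobounded2 sup.cobounded1 sup.cobounded2)+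
  \<comment> \<open>If \<open>u \<le> v\<close>, then \<open>u = e\<close> and \<open>v = t\<close>,
    so \<open>w = inf v w = e\<close> and \<open>t = sup u w = e\<close>.\<close>
  have incomparable: "\<not> u \<le> v"
    if "inf u v = e" "inf v w = e" "sup u v = t" "sup u w = t" "w \<le> t" for u v w
  proof
    assume "u \<le> v"
    with that have "u = e" "v = t" by (auto simp: inf_absorb1 sup_absorb2)
    with that have "w = e" by (simp add: inf_absorb2)
    with \<open>u = e\<close> that assms(7) show False by simp
  qed
  have nle: "\<not> a \<le> b" "\<not> b \<le> a" "\<not> b \<le> c" "\<not> c \<le> b" "\<not> a \<le> c" "\<not> c \<le> a"
    using assms le incomparable[of a b c] incomparable[of b a c] incomparable[of b c a]
      incomparable[of c b a] incomparable[of a c b] incomparable[of c a b]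
    by (simp_all add: inf_commute sup_commute)
  have ne: "a \<noteq> e" "b \<noteq> e" "c \<noteq> e" "a \<noteq> t" "b \<noteq> t" "c \<noteq> t" "a \<noteq> b" "b \<noteq> c" "a \<noteq> c"
    using le nle by auto
  have nle': "\<not> a \<le> e" "\<not> b \<le> e" "\<not> c \<le> e" "\<not> t \<le> a" "\<not> t \<le> b" "\<not> t \<le> c" "\<not> t \<le> e" "e \<le> t"
    using le ne assms(7) by (auto dest: order.antisym order.trans)
  let ?S = "{e, a, b, c, t}"
  define \<phi> :: "'a \<Rightarrow> nat set" where
    "\<phi> z = (if z = e then {} else if z = a then {0} else if z = b then {1}
      else if z = c then {2} else {0, 1, 2})" for z
  have \<phi>: "\<phi> e = {}" "\<phi> a = {0}" "\<phi> b = {1}" "\<phi> c = {2}" "\<phi> t = {0, 1, 2}"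
    using ne assms(7) by (auto simp: \<phi>_def)
  have "inf b a = e" "inf c b = e" "inf c a = e" "sup b a = t" "sup c b = t" "sup c a = t"
    using assms(1-6) by (simp_all only: inf_commute[of b a] inf_commute[of c]
        sup_commute[of b a] sup_commute[of c])
  then have "sublattice ?S"
    using assms(1-6) le \<open>e \<le> t\<close> unfolding sublattice_def
    by (simp add: inf_absorb1 inf_absorb2 sup_absorb1 sup_absorb2)
  moreover have "order_isomorphic ?S M3"
    unfolding order_isomorphic_def
  proof (intro exI conjI)
    show mono: "\<forall>u\<in>?S. \<forall>v\<in>?S. u \<le> v \<longleftrightarrow> \<phi> u \<le> \<phi> v"
      using le nle nle' by (simp add: \<phi>)
    have "inj_on \<phi> ?S"
    proof (rule inj_onI)
      fix u v assume "u \<in> ?S" "v \<in> ?S" "\<phi> u = \<phi> v"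
      then have "u \<le> v" "v \<le> u" using mono by (metis order_refl)+
      then show "u = v" by (rule order.antisym)
    qed
    moreover have "\<phi> ` ?S = M3" by (auto simp: \<phi> M3_def)
    ultimately show "bij_betw \<phi> ?S M3" by (simp add: bij_betw_def)
  qed
  ultimately show ?thesis by blast
qed

text \<open>By induction on \<open>t\<close>, only a pair with \<open>sup j j' = t\<close> can
  violate uniqueness. Lower covers \<open>d\<close> above \<open>j\<close> and \<open>d'\<close>
  above \<open>j'\<close> join \<open>c\<close> to form three pairwise distinct lower covers of
  \<open>t\<close>. They either generate a diamond or contradict uniqueness below
  \<open>d\<close>.\<close>

lemma covers_unique_join_irreducible:
  fixes t c j j' :: "'a::{finite,bounded_lattice_bot}"
  assumes lld: "lower_locally_distributive TYPE('a)"
  shows "t covers c \<Longrightarrow> j \<in> join_irreducibles \<Longrightarrow> j \<le> t \<Longrightarrow> \<not> j \<le> c \<Longrightarrow>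
    j' \<in> join_irreducibles \<Longrightarrow> j' \<le> t \<Longrightarrow> \<not> j' \<le> c \<Longrightarrow> j = j'"
proof (induction t arbitrary: c j j' rule: finite_order_less_induct)
  case (less t)
  note tc = less.prems(1)
  have lsm: "lower_semimodular TYPE('a)"
    and noM3: "\<not> (\<exists>S :: 'a set. sublattice S \<and> order_isomorphic S M3)"
    using lld by (auto simp: lower_locally_distributive_def)
  show ?case
  proof (rule ccontr)
    assume "j \<noteq> j'"
    \<comment> \<open>A smaller join covers its meet with \<open>c\<close>, so the pair would
      already violate uniqueness there.\<close>
    have top: "sup j j' = t"
    proof (rule ccontr)
      assume "sup j j' \<noteq> t"
      then have lt: "sup j j' < t" using less.prems by (simp add: order.not_eq_order_implies_strict)
      have "sup j j' covers inf (sup j j') c"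
        using less.prems by (intro lower_semimodular_covers_inf[OF lsm tc]) auto
      then show False using less.IH[OF lt, of "inf (sup j j') c" j j'] less.prems \<open>j \<noteq> j'\<close> by auto
    qed
    \<comment> \<open>If \<open>j = t\<close>, then \<open>c\<close> is the only lower cover of
      \<open>j\<close>, and \<open>j' < j\<close> would give \<open>j' \<le> c\<close>.\<close>
    have "j \<noteq> t" "j' \<noteq> t"
      using join_irreducible_covers_above[of j c j'] join_irreducible_covers_above[of j' c j]
        less.prems \<open>j \<noteq> j'\<close> by (auto simp: order.order_iff_strict)
    then obtain d d' where d: "t covers d" "j \<le> d" and d': "t covers d'" "j' \<le> d'"
      using ex_covers_above[of j t] ex_covers_above[of j' t] less.prems
      by (auto simp: order.order_iff_strict)
    have nle: "\<not> d \<le> c" "\<not> d' \<le> c"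
      using d(2) d'(2) less.prems by (auto dest: order.trans)
    have njd': "\<not> j \<le> d'"
      using top d'(2) covers_less[OF d'(1)] le_supI leD by blast
    then have "\<not> d \<le> d'" using d(2) by (auto dest: order.trans)
    have d_cov: "d covers inf d c" "d covers inf d d'" "d' covers inf d' c"
      using lower_semimodular_covers_inf[OF lsm tc, of d] lower_semimodular_covers_inf[OF lsm tc, of d']
        lower_semimodular_covers_inf[OF lsm d'(1), of d] nle \<open>\<not> d \<le> d'\<close> covers_less[OF d(1)]
        covers_less[OF d'(1)] by auto
    have "\<not> d' \<le> d"
      using \<open>\<not> d \<le> d'\<close> covers_eqI[OF d'(1), of d] covers_less[OF d(1)] by auto
    then have d'_cov: "d' covers inf d d'"
      using lower_semimodular_covers_inf[OF lsm d(1), of d'] covers_less[OF d'(1)]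
      by (simp add: inf_commute)
    have sups: "sup d c = t" "sup d d' = t" "sup d' c = t"
      using covers_sup_eq[OF tc, of d] covers_sup_eq[OF tc, of d'] covers_sup_eq[OF d'(1), of d]
        nle \<open>\<not> d \<le> d'\<close> covers_less[OF d(1)] covers_less[OF d'(1)] by auto
    show False
    proof (cases "inf d d' \<le> c")
      case True
      \<comment> \<open>\<open>inf d d'\<close> is below \<open>inf d c\<close>, which is strictly
        below \<open>d\<close>; since \<open>d\<close> covers \<open>inf d d'\<close>, the two meets
        agree. So all three pairwise meets coincide.\<close>
      have "inf d c = inf d d'"
        using covers_eqI[OF d_cov(2) _ covers_less[OF d_cov(1)]] True by auto
      moreover have "inf d' c = inf d d'"
        using covers_eqI[OF d'_cov _ covers_less[OF d_cov(3)]] True by auto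
      moreover have "inf d d' \<noteq> t" using covers_less[OF d(1)] by (metis inf.cobounded1 leD)
      ultimately have "\<exists>S :: 'a set. sublattice S \<and> order_isomorphic S M3"
        using M3_sublattice[of d d' "inf d d'" c t] sups by auto
      with noM3 show False by contradiction
    next
      case False
      \<comment> \<open>Uniqueness for \<open>d\<close> over \<open>inf d c\<close> identifies
        \<open>i\<close> with \<open>j\<close>, although \<open>i \<le> d'\<close> and
        \<open>j\<close> is not below \<open>d'\<close>.\<close>
      then obtain i where i: "i \<in> join_irreducibles" "i \<le> inf d d'" "\<not> i \<le> c"
        using ex_join_irreducible by blast
      then have "i = j"
        using less.IH[OF covers_less[OF d(1)] d_cov(1), of i j] d(2) less.prems by auto
      with i njd' show False by auto
    qed
  qed
qed

section \<open>Minimal decompositions\<close>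

text \<open>Each lower cover \<open>c\<close> of \<open>y\<close> forces into every decomposition an
  element not below \<open>c\<close>, and only one join-irreducible element below \<open>y\<close>
  qualifies. These forced elements already join to \<open>y\<close>, since no lower cover of
  \<open>y\<close> lies above all of them.\<close>

lemma ex_least_decomposition:
  fixes y :: "'a::finite_lattice_complete"
  assumes lld: "lower_locally_distributive TYPE('a)"
  shows "\<exists>E. decomposition y E \<and> (\<forall>\<eta>. decomposition y \<eta> \<longrightarrow> E \<subseteq> \<eta>)"
proof -
  define E where "E = {j \<in> join_irreducibles. j \<le> y \<and> (\<exists>c. y covers c \<and> \<not> j \<le> c)}"
  have "Sup E = y"
  proof (rule ccontr)
    assume "Sup E \<noteq> y"
    moreover have "Sup E \<le> y" by (rule Sup_least) (simp add: E_def)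
    ultimately obtain c where c: "y covers c" "Sup E \<le> c"
      using ex_covers_above[of "Sup E" y] by (auto simp: less_le)
    then have "\<not> y \<le> c" using covers_less by fastforce
    then obtain j where "j \<in> join_irreducibles" "j \<le> y" "\<not> j \<le> c"
      using ex_join_irreducible by blast
    moreover from this c(1) have "j \<in> E" by (auto simp: E_def)
    ultimately show False using c(2) Sup_upper order.trans by blast
  qed
  then have "decomposition y E" by (auto simp: decomposition_def E_def)
  moreover have "E \<subseteq> \<eta>" if \<eta>: "decomposition y \<eta>" for \<eta>
  proof
    fix j assume "j \<in> E"
    then obtain c where j: "j \<in> join_irreducibles" "j \<le> y" "y covers c" "\<not> j \<le> c"
      by (auto simp: E_def)
    have "\<not> Sup \<eta> \<le> c"
      using \<eta> covers_less[OF j(3)] by (auto simp: decomposition_def)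
    then obtain i where i: "i \<in> \<eta>" "\<not> i \<le> c" using Sup_least by blast
    then have "i \<in> join_irreducibles" "i \<le> y"
      using \<eta> by (auto simp: decomposition_def intro: Sup_upper)
    then have "i = j" using covers_unique_join_irreducible[OF lld j(3)] i j by blast
    with i show "j \<in> \<eta>" by simp
  qed
  ultimately show ?thesis by blast
qed

text \<open>Justifies the definite description in \<open>min_decomposition\<close>: a decomposition
  of minimal cardinality contains the inclusion-least one and is no larger, so it equals it.\<close>

lemma decomposition_min_decomposition:
  fixes y :: "'a::finite_lattice_complete"
  assumes lld: "lower_locally_distributive TYPE('a)"
  shows "decomposition y (min_decomposition y)"
proof -
  obtain E where E: "decomposition y E" "\<And>\<eta>. decomposition y \<eta> \<Longrightarrow> E \<subseteq> \<eta>"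
    using ex_least_decomposition[OF lld] by blast
  have "min_decomposition y = E"
    unfolding min_decomposition_def
  proof (rule the_equality)
    show "decomposition y E \<and> (\<forall>\<eta>'. decomposition y \<eta>' \<longrightarrow> card E \<le> card \<eta>')"
      using E by (meson card_mono finite)
  next
    fix \<eta> assume "decomposition y \<eta> \<and> (\<forall>\<eta>'. decomposition y \<eta>' \<longrightarrow> card \<eta> \<le> card \<eta>')"
    then show "\<eta> = E" using E by (metis card_seteq finite)
  qed
  with E(1) show ?thesis by simp
qed

section \<open>Boolean intervals\<close>

text \<open>Extracts what is needed from the isomorphism: the number of coatoms, and that an element
  of the interval is determined by the coatoms above it.\<close>

lemma boolean_interval_coatoms:
  fixes x t :: "'a::lattice"
  assumes "order_isomorphic {x..t} (Pow {..<k})" "x \<le> t"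
  shows "\<exists>C. card C = k \<and> (\<forall>c\<in>C. t covers c \<and> x \<le> c) \<and>
    (\<forall>u\<in>{x..t}. \<forall>v\<in>{x..t}. (\<forall>c\<in>C. u \<le> c \<longrightarrow> v \<le> c) \<longrightarrow> v \<le> u)"
proof -
  let ?I = "{x..t}"
  obtain \<phi> where bij: "bij_betw \<phi> ?I (Pow {..<k})"
    and iso: "\<forall>a\<in>?I. \<forall>b\<in>?I. a \<le> b \<longleftrightarrow> \<phi> a \<subseteq> \<phi> b"
    using assms(1) unfolding order_isomorphic_def by blast
  have mono: "a \<le> b \<longleftrightarrow> \<phi> a \<subseteq> \<phi> b" if "a \<in> ?I" "b \<in> ?I" for a b
    using iso that by blast
  define g where "g = inv_into ?I \<phi>"
  have g: "g X \<in> ?I" "\<phi> (g X) = X" if "X \<subseteq> {..<k}" for X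
    using bij that unfolding g_def
    by (auto simp: bij_betw_def f_inv_into_f intro!: inv_into_into
        simp del: atLeastAtMost_iff)
  have \<phi>_sub: "\<phi> a \<subseteq> {..<k}" if "a \<in> ?I" for a
    using bij_betwE[OF bij] that by (simp del: atLeastAtMost_iff)
  have \<phi>t: "\<phi> t = {..<k}"
    using g[of "{..<k}"] mono[of "g {..<k}" t] \<phi>_sub[of t] assms(2) by auto
  \<comment> \<open>The coatoms of a power set are the complements of singletons.\<close>
  define co where "co i = g ({..<k} - {i})" for i
  have co: "co i \<in> ?I" "\<phi> (co i) = {..<k} - {i}" for i
    unfolding co_def using g[of "{..<k} - {i}"] by auto
  have inj: "inj_on co {..<k}"
  proof (rule inj_onI)
    fix i j assume *: "i \<in> {..<k}" "j \<in> {..<k}" "co i = co j"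
    then have "{..<k} - {i} = {..<k} - {j}" using co(2) by metis
    with * show "i = j" by blast
  qed
  have le_co: "u \<le> co i \<longleftrightarrow> i \<notin> \<phi> u" if "u \<in> ?I" for u i
    using mono[OF that co(1)] co(2) \<phi>_sub[OF that] by auto
  have cov: "t covers co i" if "i < k" for i
    unfolding covers_def
  proof (intro conjI notI)
    have "\<not> t \<le> co i" using le_co[of t i] \<phi>t that assms(2) by simp
    then show "co i < t" using co(1)[of i] by (auto simp: order.order_iff_strict)
  next
    assume "\<exists>z. co i < z \<and> z < t"
    then obtain z where z: "co i < z" "z < t" by blast
    have "z \<in> ?I" using z co(1)[of i] by (auto dest: order.strict_implies_order order.trans)
    then have "{..<k} - {i} \<subseteq> \<phi> z" "i \<in> \<phi> z"
      using mono[OF co(1), of z i] co(2) le_co[of z i] z by auto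
    then have "\<phi> t \<subseteq> \<phi> z" using \<phi>t by auto
    then have "t \<le> z" using mono[of t z] \<open>z \<in> ?I\<close> assms(2) by auto
    with z show False by auto
  qed
  show ?thesis
  proof (intro exI[of _ "co ` {..<k}"] conjI ballI impI)
    show "card (co ` {..<k}) = k" using inj by (simp add: card_image)
  next
    fix u v assume "u \<in> ?I" "v \<in> ?I" and "\<forall>c\<in>co ` {..<k}. u \<le> c \<longrightarrow> v \<le> c"
    then have "\<forall>i<k. i \<notin> \<phi> u \<longrightarrow> i \<notin> \<phi> v" using le_co by auto
    then show "v \<le> u" using mono \<phi>_sub \<open>u \<in> ?I\<close> \<open>v \<in> ?I\<close> by blast
  qed (use cov co(1) in auto)
qed

lemma boolean_derivative_le_sup_Sup_iff:
  fixes x y z :: "'a::finite_lattice_complete"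
  assumes lld: "lower_locally_distributive TYPE('a)"
    and "boolean_derivative y x"
    and S: "S \<subseteq> min_decomposition y"
  shows "z \<le> sup x (Sup S) \<longleftrightarrow> z \<le> sup x y \<and> {p \<in> min_decomposition y. p \<le> z} \<subseteq> S"
proof -
  let ?t = "sup x y" and ?P = "min_decomposition y"
  note uniq = covers_unique_join_irreducible[OF lld]
  obtain C where "card C = card ?P"
    and coatoms: "\<forall>c\<in>C. ?t covers c \<and> x \<le> c"
    and meet: "\<forall>u\<in>{x..?t}. \<forall>v\<in>{x..?t}. (\<forall>c\<in>C. u \<le> c \<longrightarrow> v \<le> c) \<longrightarrow> v \<le> u"
    using boolean_interval_coatoms[OF assms(2)[unfolded boolean_derivative_def] sup.cobounded1]
    by blast
  have C: "?t covers c" "x \<le> c" if "c \<in> C" for c using coatoms that by auto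
  have P: "?P \<subseteq> join_irreducibles" "Sup ?P = y"
    using decomposition_min_decomposition[OF lld] by (auto simp: decomposition_def)
  have P_le: "p \<le> ?t" if "p \<in> ?P" for p
    using Sup_upper[OF that] P(2) by (simp add: le_supI2)
  \<comment> \<open>Otherwise \<open>y \<le> c\<close>, and with \<open>x \<le> c\<close> also
    \<open>?t \<le> c\<close>.\<close>
  have "\<exists>p\<in>?P. \<not> p \<le> c" if "c \<in> C" for c
  proof (rule ccontr)
    assume "\<not> (\<exists>p\<in>?P. \<not> p \<le> c)"
    then have "y \<le> c" using Sup_least[of ?P c] P(2) by auto
    with C[OF that] show False using covers_less[of ?t c] by (simp add: less_le_not_le)
  qed
  then obtain q where q: "\<And>c. c \<in> C \<Longrightarrow> q c \<in> ?P" "\<And>c. c \<in> C \<Longrightarrow> \<not> q c \<le> c"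
    by metis
  \<comment> \<open>\<open>q c\<close> is the only join-irreducible element below \<open>?t\<close>
    but not below \<open>c\<close>, so any \<open>v \<le> ?t\<close> not below \<open>c\<close> must
    lie above it.\<close>
  have le_iff: "v \<le> c \<longleftrightarrow> \<not> q c \<le> v" if "c \<in> C" "v \<le> ?t" for c v
  proof
    show "v \<le> c \<Longrightarrow> \<not> q c \<le> v" using q(2)[OF that(1)] order.trans by blast
  next
    assume "\<not> q c \<le> v"
    show "v \<le> c"
    proof (rule ccontr)
      assume "\<not> v \<le> c"
      then obtain j where j: "j \<in> join_irreducibles" "j \<le> v" "\<not> j \<le> c"
        using ex_join_irreducible by blast
      then have "j = q c"
        using uniq[OF C(1)[OF that(1)], of j "q c"] q[OF that(1)] P(1) P_le that(2) order.trans by blast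
      with j \<open>\<not> q c \<le> v\<close> show False by simp
    qed
  qed
  have C_le: "c \<le> c' \<longleftrightarrow> c = c'" if "c \<in> C" "c' \<in> C" for c c'
    using covers_eqI[OF C(1) _ covers_less[OF C(1)]] that by blast
  \<comment> \<open>Distinct coatoms are incomparable, so \<open>c'\<close> is not below
    \<open>c\<close> and hence lies above \<open>q c\<close>. This makes \<open>q\<close>
    injective.\<close>
  have q_le: "q c \<le> c'" if "c \<in> C" "c' \<in> C" "c \<noteq> c'" for c c'
    using C_le[OF that(2,1)] le_iff[OF that(1), of c'] covers_less[OF C(1)[OF that(2)]] that(3)
    by (auto dest: less_imp_le)
  have "inj_on q C"
    using q_le q(2) by (metis inj_onI)
  then have "card (q ` C) = card ?P" using \<open>card C = card ?P\<close> by (simp add: card_image)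
  \<comment> \<open>Here the rank of the interval being \<open>card ?P\<close> is decisive: an
    injective image of \<open>C\<close> inside \<open>?P\<close> exhausts it.\<close>
  then have P_eq: "?P = q ` C" using q(1) by (metis card_subset_eq finite image_subsetI)
  let ?u = "sup x (Sup S)"
  have u: "?u \<in> {x..?t}" using Sup_subset_mono[OF S] P(2) by (auto intro: le_supI2)
  have u_le: "?u \<le> c \<longleftrightarrow> q c \<notin> S" if "c \<in> C" for c
  proof
    show "?u \<le> c \<Longrightarrow> q c \<notin> S"
      using q(2)[OF that] by (auto dest: order.trans[OF Sup_upper])
  next
    assume "q c \<notin> S"
    then have "s \<le> c" if "s \<in> S" for s
      using that S P_eq q_le[OF _ \<open>c \<in> C\<close>] by auto
    then show "?u \<le> c" using C(2)[OF that] by (auto intro: Sup_least)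
  qed
  show ?thesis
  proof
    assume z: "z \<le> ?u"
    have "q c \<in> S" if "c \<in> C" "q c \<le> z" for c
      using le_iff[OF that(1), of ?u] u u_le[OF that(1)] z that(2) by (auto dest: order.trans)
    then show "z \<le> ?t \<and> {p \<in> ?P. p \<le> z} \<subseteq> S"
      using order.trans[OF z] u by (auto simp: P_eq)
  next
    assume z: "z \<le> ?t \<and> {p \<in> ?P. p \<le> z} \<subseteq> S"
    \<comment> \<open>Elements are compared through coatoms only within the interval, so
      \<open>z\<close> is replaced by \<open>sup z x\<close>.\<close>
    have "\<forall>c\<in>C. ?u \<le> c \<longrightarrow> sup z x \<le> c"
    proof (intro ballI impI)
      fix c assume "c \<in> C" "?u \<le> c"
      then have "q c \<notin> S" using u_le by blast
      then have "\<not> q c \<le> z" using z q(1)[OF \<open>c \<in> C\<close>] by blast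
      then show "sup z x \<le> c" using le_iff[OF \<open>c \<in> C\<close>] z C(2)[OF \<open>c \<in> C\<close>] by simp
    qed
    then have "sup z x \<le> ?u" using meet[rule_format, OF u, of "sup z x"] z by simp
    then show "z \<le> ?u" by simp
  qed
qed

section \<open>Iterated differences of the Moebius sum\<close>

theorem theorem2:
  fixes f m :: "'a::finite_lattice_complete \<Rightarrow> real" and x y :: 'a
  assumes "lower_locally_distributive TYPE('a)"
    and "\<forall>x. f x = (\<Sum>y\<in>{..x}. m y)"
    and "boolean_derivative y x"
  shows "derivative y f x = (\<Sum>z\<in>{y..sup x y}. m z)"
proof -
  interpret comp_fun_commute "irr_derivative :: 'a \<Rightarrow> ('a \<Rightarrow> real) \<Rightarrow> 'a \<Rightarrow> real"
    by (rule comp_fun_commute_irr_derivative)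
  let ?P = "min_decomposition y"
  note le_iff = boolean_derivative_le_sup_Sup_iff[OF assms(1,3)]
  have Sup_P: "Sup ?P = y"
    using decomposition_min_decomposition[OF assms(1)] by (simp add: decomposition_def)
  \<comment> \<open>The base point must vary: taking the difference for \<open>p\<close> evaluates
    the inner derivative also at the point joined with \<open>p\<close>. The set \<open>S\<close>
    records the elements joined so far.\<close>
  have partial: "Finite_Set.fold irr_derivative f T (sup x (Sup S)) =
      (\<Sum>z | z \<le> sup x (Sup (S \<union> T)) \<and> (\<forall>p\<in>T. p \<le> z). m z)"
    if "T \<subseteq> ?P" "S \<subseteq> ?P" "S \<inter> T = {}" for S T
    using finite[of T] that
  proof (induction T arbitrary: S rule: finite_induct)
    case empty
    then show ?case using assms(2) by (simp add: atMost_def)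
  next
    case (insert p T)
    let ?A = "{z. z \<le> sup x (Sup (insert p S \<union> T)) \<and> (\<forall>q\<in>T. q \<le> z)}"
    let ?B = "{z. z \<le> sup x (Sup (S \<union> T)) \<and> (\<forall>q\<in>T. q \<le> z)}"
    \<comment> \<open>The two upper bounds differ only by admitting \<open>p\<close> among the
      elements of \<open>?P\<close> below \<open>z\<close>, and \<open>p\<close> is not in
      \<open>S \<union> T\<close>. So the difference leaves exactly the \<open>z\<close> above
      \<open>p\<close>.\<close>
    have "z \<in> ?B \<longleftrightarrow> z \<in> ?A \<and> \<not> p \<le> z" for z
      using le_iff[of "S \<union> T" z] le_iff[of "insert p S \<union> T" z] insert.prems insert.hyps by auto
    then have B: "?B \<subseteq> ?A" and diff: "?A - ?B = {z \<in> ?A. p \<le> z}" by blast+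
    have "Finite_Set.fold irr_derivative f (insert p T) (sup x (Sup S)) =
        Finite_Set.fold irr_derivative f T (sup x (Sup (insert p S))) -
        Finite_Set.fold irr_derivative f T (sup x (Sup S))"
      using insert.hyps by (simp add: irr_derivative_def ac_simps)
    also have "\<dots> = sum m ?A - sum m ?B"
      using insert.IH[of "insert p S"] insert.IH[of S] insert.prems insert.hyps by simp
    also have "\<dots> = sum m (?A - ?B)" using B by (simp add: sum_diff)
    also have "?A - ?B = {z. z \<le> sup x (Sup (S \<union> insert p T)) \<and> (\<forall>q\<in>insert p T. q \<le> z)}"
      unfolding diff by auto
    finally show ?case .
  qed
  \<comment> \<open>With \<open>S\<close> empty and \<open>T\<close> all of \<open>?P\<close>, the
    conditions \<open>p \<le> z\<close> combine to \<open>y \<le> z\<close>, because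
    \<open>Sup ?P = y\<close>.\<close>
  have "derivative y f x = (\<Sum>z | z \<le> sup x y \<and> (\<forall>p\<in>?P. p \<le> z). m z)"
    using partial[of ?P "{}"] Sup_P by (simp add: derivative_def)
  also have "{z. z \<le> sup x y \<and> (\<forall>p\<in>?P. p \<le> z)} = {y..sup x y}"
    using Sup_le_iff[of ?P] Sup_P by auto
  finally show ?thesis .
qed

end
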